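(* For all integers $n\geq 0$, $p_{\mathrm{eu}}^{\mathrm{od}}(n)\leq p^{\mathrm{ed}}_{\mathrm{ou}}(n)$. Moreover, $p_{\mathrm{eu}}^{\mathrm{od}}(n)< p^{\mathrm{ed}}_{\mathrm{ou}}(n)$ for all $n\geq 2$.
   Context: A partition of a non-negative integer $n$ is a non-increasing (finite, possibly empty) sequence of positive integers, called parts, summing to $n$. $p_{\mathrm{eu}}^{\mathrm{od}}(n)$ is the number of partitions of $n$ in which every odd part is larger than every even part, the odd parts are pairwise distinct, and the even parts are unrestricted (may be repeated). $p^{\mathrm{ed}}_{\mathrm{ou}}(n)$ is the number of partitions of $n$ in which every even part is larger than every odd part, the even parts are pairwise distinct, and the odd parts are unrestricted (may be repeated). In both cases partitions with no even parts or with no odd parts are allowed. *)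

theory Defs
  imports Main
begin

definition partitions :: "nat \<Rightarrow> nat list set" where
  "partitions n = {xs. sorted_wrt (\<ge>) xs \<and> (\<forall>x\<in>set xs. x > 0) \<and> sum_list xs = n}"

(* Finiteness makes the cardinalities below genuine counts. *)
lemma finite_partitions: "finite (partitions n)"
proof -
  have len: "length xs \<le> sum_list xs" if "\<forall>x\<in>set xs. x > 0" for xs :: "nat list"
    using that by (induction xs) auto
  have "partitions n \<subseteq> {xs. set xs \<subseteq> {..n} \<and> length xs \<le> n}"
    using len by (fastforce simp: partitions_def dest: member_le_sum_list)
  then show ?thesis
    by (rule finite_subset) (simp add: finite_lists_length_le)
qed

definition p_eu_od :: "nat \<Rightarrow> nat" where
  "p_eu_od n = card {xs \<in> partitions n.
     (\<forall>a\<in>set xs. \<forall>b\<in>set xs. odd a \<and> even b \<longrightarrow> a > b) \<and> distinct (filter odd xs)}"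

definition p_ou_ed :: "nat \<Rightarrow> nat" where
  "p_ou_ed n = card {xs \<in> partitions n.
     (\<forall>a\<in>set xs. \<forall>b\<in>set xs. even a \<and> odd b \<longrightarrow> a > b) \<and> distinct (filter even xs)}"

end

theory Submission
  imports Defs
begin

text \<open>
  Removing the staircase \<open>2k - 1, \<dots>, 3, 1\<close>, of sum \<open>k\<^sup>2\<close>, from the \<open>k\<close> largest parts turns a
  partition counted by \<open>p_eu_od n\<close> with \<open>k\<close> odd parts into a partition of \<open>n - k\<^sup>2\<close> into even parts,
  and one counted by \<open>p_ou_ed n\<close> with \<open>k\<close> even parts into a partition of \<open>n - k\<^sup>2\<close> into at least \<open>k\<close>
  odd parts. It remains to inject the even pairs \<open>(k, xs)\<close> into the odd ones. If \<open>xs\<close> has \<open>p\<close> parts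
  and \<open>k \<le> 2p\<close>, keep \<open>k\<close> and split each part \<open>x\<close> into \<open>(x - 1) + 1\<close>. Otherwise write \<open>k\<^sup>2\<close> as \<open>k\<close>
  copies of \<open>k\<close> if \<open>k\<close> is odd, and as \<open>1\<close> plus \<open>k - 1\<close> copies of \<open>k + 1\<close> if \<open>k\<close> is even, and add the
  parts of \<open>xs\<close> to the first \<open>p\<close> copies; this goes to the index \<open>0\<close> resp. \<open>1\<close>, of parity opposite to
  \<open>n\<close>, which the first case never uses. The partition into ones at that index is not attained.
\<close>

section \<open>Staircases, and pairs of an index and a partition\<close>

fun add_staircase :: "nat \<Rightarrow> nat list \<Rightarrow> nat list" where
  "add_staircase 0 ys = ys"
| "add_staircase (Suc k) [] = (2 * k + 1) # add_staircase k []"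
| "add_staircase (Suc k) (y # ys) = (y + 2 * k + 1) # add_staircase k ys"

definition even_pairs :: "nat \<Rightarrow> (nat \<times> nat list) set" where
  "even_pairs n = {(k, xs). sorted_wrt (\<ge>) xs \<and> (\<forall>x\<in>set xs. x > 0 \<and> even x) \<and>
     sum_list xs + k * k = n}"

text \<open>The bound \<open>k \<le> length ys\<close> keeps \<open>add_staircase\<close> from
  padding \<open>ys\<close> with zeros: a padded entry would come out odd, but the first
  \<open>k\<close> entries must turn even. In \<open>even_pairs\<close> padding is harmless, as it
  yields odd parts.\<close>

definition odd_pairs :: "nat \<Rightarrow> (nat \<times> nat list) set" where
  "odd_pairs n = {(k, ys). sorted_wrt (\<ge>) ys \<and> (\<forall>y\<in>set ys. odd y) \<and>
     sum_list ys + k * k = n \<and> k \<le> length ys}"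

text \<open>The guard \<open>k * k \<le> n\<close> bounds \<open>k\<close>; truncated subtraction
  alone would admit \<open>(k, [])\<close> for every large \<open>k\<close>.\<close>

lemma finite_partition_pairs:
  "finite {(k, xs). xs \<in> partitions (n - k * k) \<and> k * k \<le> n}"
proof -
  have "{(k, xs). xs \<in> partitions (n - k * k) \<and> k * k \<le> n}
      \<subseteq> (SIGMA k:{..n}. partitions (n - k * k))"
    by (auto intro: le_trans[OF le_square])
  then show ?thesis
    by (rule finite_subset) (auto intro: finite_partitions)
qed

lemma finite_even_pairs: "finite (even_pairs n)"
proof -
  have "even_pairs n \<subseteq> {(k, xs). xs \<in> partitions (n - k * k) \<and> k * k \<le> n}"
    unfolding even_pairs_def partitions_def by force
  then show ?thesis
    using finite_partition_pairs by (rule finite_subset)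
qed

lemma finite_odd_pairs: "finite (odd_pairs n)"
proof -
  have "odd_pairs n \<subseteq> {(k, ys). ys \<in> partitions (n - k * k) \<and> k * k \<le> n}"
    unfolding odd_pairs_def partitions_def using odd_pos by force
  then show ?thesis
    using finite_partition_pairs by (rule finite_subset)
qed

section \<open>Removing the staircase from distinct odd parts\<close>

text \<open>Induction splits off the largest part. If it is even, no odd part occurs. If it is odd,
  it exceeds any other odd part by at least 2, one stair, so subtracting \<open>2 * k + 1\<close>
  leaves an even number no smaller than the head of \<open>ys\<close>.\<close>

lemma add_staircase_surj:
  assumes "sorted_wrt (\<ge>) xs" "\<forall>x\<in>set xs. x > 0"
    "\<forall>a\<in>set xs. \<forall>b\<in>set xs. odd a \<and> even b \<longrightarrow> a > b" "distinct (filter odd xs)"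
  shows "\<exists>ys. sorted_wrt (\<ge>) ys \<and> (\<forall>y\<in>set ys. y > 0 \<and> even y) \<and>
    add_staircase (length (filter odd xs)) ys = xs \<and>
    sum_list ys + length (filter odd xs) * length (filter odd xs) = sum_list xs"
  using assms
proof (induction xs)
  case Nil
  then show ?case by simp
next
  case (Cons x xs)
  show ?case
  proof (cases "odd x")
    case False
    have ev: "\<forall>y\<in>set xs. even y"
    proof (intro ballI, rule ccontr)
      fix y assume "y \<in> set xs" "odd y"
      then have "x < y" using Cons.prems(3) False by simp
      then show False using Cons.prems(1) \<open>y \<in> set xs\<close> by auto
    qed
    then have "filter odd xs = []" by (simp add: filter_empty_conv)
    then show ?thesis
      using Cons.prems False ev by (intro exI[of _ "x # xs"]) auto
  next
    case True
    define k where "k = length (filter odd xs)"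
    obtain ys where ys: "sorted_wrt (\<ge>) ys" "\<forall>y\<in>set ys. y > 0 \<and> even y"
      "add_staircase k ys = xs" "sum_list ys + k * k = sum_list xs"
    proof -
      have "sorted_wrt (\<ge>) xs" "\<forall>x\<in>set xs. x > 0"
        "\<forall>a\<in>set xs. \<forall>b\<in>set xs. odd a \<and> even b \<longrightarrow> a > b" "distinct (filter odd xs)"
        using Cons.prems True by simp_all
      from Cons.IH[OF this] show thesis
        unfolding k_def[symmetric] using that by blast
    qed
    have lt: "y < x" if "y \<in> set xs" for y
    proof -
      have "y \<le> x" using Cons.prems(1) that by simp
      moreover have "y \<noteq> x" using Cons.prems(4) True that by auto
      ultimately show ?thesis by simp
    qed
    have step: "y + 2 \<le> x" if "y \<in> set xs" "odd y" for y
      using lt[OF that(1)] that(2) True by presburger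
    show ?thesis
    proof (cases ys)
      case Nil
      \<comment> \<open>Now \<open>xs\<close> is a bare staircase; for \<open>k > 0\<close> its head
        is \<open>2 * k - 1\<close>, and the next odd value is two larger.\<close>
      have "2 * k + 1 \<le> x"
      proof (cases k)
        case 0
        then show ?thesis using True by (auto elim: oddE)
      next
        case (Suc j)
        then have "2 * j + 1 \<in> set xs" using ys(3) Nil by auto
        then show ?thesis using step Suc by fastforce
      qed
      define r where "r = x - (2 * k + 1)"
      have r: "x = r + 2 * k + 1" "even r"
        using \<open>2 * k + 1 \<le> x\<close> True unfolding r_def by auto
      show ?thesis
      proof (cases "r = 0")
        \<comment> \<open>Zero is not a part, so the witness stays empty and padding restores
          \<open>x\<close>.\<close>
        case True
        then show ?thesis using ys Nil r \<open>odd x\<close>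
          by (intro exI[of _ "[]"]) (auto simp: k_def[symmetric])
      next
        case False
        then show ?thesis using ys Nil r \<open>odd x\<close>
          by (intro exI[of _ "[r]"]) (auto simp: k_def[symmetric])
      qed
    next
      case (Cons y zs)
      have "y + 2 * k + 1 \<le> x"
      proof (cases k)
        case 0
        then have "y \<in> set xs" using ys(3) Cons by auto
        then show ?thesis using lt 0 by fastforce
      next
        case (Suc j)
        then have "y + 2 * j + 1 \<in> set xs" using ys(3) Cons by auto
        moreover have "odd (y + 2 * j + 1)" using ys(2) Cons by auto
        ultimately show ?thesis using step Suc by fastforce
      qed
      define r where "r = x - (2 * k + 1)"
      have r: "x = r + 2 * k + 1" "even r" "y \<le> r"
        using \<open>y + 2 * k + 1 \<le> x\<close> True unfolding r_def by auto
      have "r > 0" using r ys(2) Cons by auto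
      then show ?thesis using ys Cons r \<open>odd x\<close>
        by (intro exI[of _ "r # ys"]) (auto simp: k_def[symmetric])
    qed
  qed
qed

lemma p_eu_od_le_card_even_pairs: "p_eu_od n \<le> card (even_pairs n)"
proof -
  have "{xs \<in> partitions n.
      (\<forall>a\<in>set xs. \<forall>b\<in>set xs. odd a \<and> even b \<longrightarrow> a > b) \<and> distinct (filter odd xs)}
    \<subseteq> (\<lambda>(k, ys). add_staircase k ys) ` even_pairs n" (is "?E \<subseteq> _")
  proof
    fix xs assume "xs \<in> ?E"
    then obtain ys where "(length (filter odd xs), ys) \<in> even_pairs n"
      "add_staircase (length (filter odd xs)) ys = xs"
      using add_staircase_surj[of xs] unfolding partitions_def even_pairs_def by auto
    then show "xs \<in> (\<lambda>(k, ys). add_staircase k ys) ` even_pairs n"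
      by (metis (no_types, lifting) case_prod_conv image_eqI)
  qed
  then show ?thesis
    unfolding p_eu_od_def using finite_even_pairs[of n] by (rule surj_card_le[rotated])
qed

section \<open>Adding the staircase to odd parts\<close>

text \<open>The second disjunct covers \<open>k = 0\<close>, where \<open>m + 2 * k - 1\<close> is
  too small. Both bounds lie below \<open>m + 2 * k + 1\<close>, so a further stair on top is
  strictly larger.\<close>

lemma add_staircase_upper:
  assumes "\<forall>y\<in>set ys. y \<le> m" "k \<le> length ys" "z \<in> set (add_staircase k ys)"
  shows "z \<le> m + 2 * k - 1 \<or> z \<le> m"
  using assms by (induction k ys rule: add_staircase.induct) fastforce+

text \<open>Odd part plus odd stair is even, so exactly the first \<open>k\<close> entries turn
  even, each exceeding all later ones. The number of even parts thus recovers \<open>k\<close>,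
  which makes the map injective on \<open>odd_pairs\<close>.\<close>

lemma add_staircase_odd_parts:
  assumes "sorted_wrt (\<ge>) ys" "\<forall>y\<in>set ys. odd y" "k \<le> length ys"
  shows "sorted_wrt (\<ge>) (add_staircase k ys) \<and>
    (\<forall>x\<in>set (add_staircase k ys). x > 0) \<and>
    (\<forall>a\<in>set (add_staircase k ys). \<forall>b\<in>set (add_staircase k ys). even a \<and> odd b \<longrightarrow> a > b) \<and>
    distinct (filter even (add_staircase k ys)) \<and>
    length (filter even (add_staircase k ys)) = k \<and>
    sum_list (add_staircase k ys) = sum_list ys + k * k"
  using assms
proof (induction k ys rule: add_staircase.induct)
  case (1 ys)
  then have "filter even ys = []" by (simp add: filter_empty_conv)
  then show ?case using 1 by (simp add: odd_pos)
next
  case (2 k)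
  then show ?case by simp
next
  case (3 k y ys)
  let ?zs = "add_staircase k ys" and ?z = "y + 2 * k + 1"
  have prems: "sorted_wrt (\<ge>) ys" "\<forall>y\<in>set ys. odd y" "k \<le> length ys" "odd y"
    "\<forall>y'\<in>set ys. y' \<le> y"
    using "3.prems" by simp_all
  note IH = "3.IH"[OF prems(1-3)]
  have less: "z < ?z" if "z \<in> set ?zs" for z
    using add_staircase_upper[OF prems(5,3) that] by linarith
  have "even ?z" using prems(4) by simp
  have "sorted_wrt (\<ge>) (?z # ?zs)" "\<forall>x\<in>set (?z # ?zs). x > 0"
    using IH less by (simp_all add: less_imp_le)
  moreover have "\<forall>a\<in>set (?z # ?zs). \<forall>b\<in>set (?z # ?zs). even a \<and> odd b \<longrightarrow> a > b"
    using IH less \<open>even ?z\<close> by (metis set_ConsD)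
  moreover have "?z \<notin> set ?zs" using less by blast
  then have "distinct (filter even (?z # ?zs))" "length (filter even (?z # ?zs)) = Suc k"
    using IH \<open>even ?z\<close> by simp_all
  moreover have "sum_list (?z # ?zs) = sum_list (y # ys) + Suc k * Suc k"
    using IH by simp
  ultimately show ?case
    unfolding add_staircase.simps by blast
qed

lemma add_staircase_inject:
  assumes "add_staircase k xs = add_staircase k ys" "k \<le> length xs" "k \<le> length ys"
  shows "xs = ys"
  using assms
proof (induction k arbitrary: xs ys)
  case (Suc k)
  then show ?case by (cases xs; cases ys) auto
qed simp

lemma card_odd_pairs_le_p_ou_ed: "card (odd_pairs n) \<le> p_ou_ed n"
proof -
  let ?f = "\<lambda>(k, ys). add_staircase k ys"
  let ?E = "{xs \<in> partitions n.
      (\<forall>a\<in>set xs. \<forall>b\<in>set xs. even a \<and> odd b \<longrightarrow> a > b) \<and> distinct (filter even xs)}"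
  have "inj_on ?f (odd_pairs n)"
  proof (rule inj_onI)
    fix p p' assume p: "p \<in> odd_pairs n" "p' \<in> odd_pairs n" "?f p = ?f p'"
    obtain k ys k' ys' where [simp]: "p = (k, ys)" "p' = (k', ys')" by fastforce
    have "k = k'"
      using p add_staircase_odd_parts[of ys k] add_staircase_odd_parts[of ys' k']
      by (auto simp: odd_pairs_def)
    moreover from this have "ys = ys'"
      using p add_staircase_inject[of k ys ys'] by (auto simp: odd_pairs_def)
    ultimately show "p = p'" by simp
  qed
  moreover have "?f p \<in> ?E" if "p \<in> odd_pairs n" for p
  proof -
    obtain k ys where "p = (k, ys)" by fastforce
    then show ?thesis
      using that add_staircase_odd_parts[of ys k]
      by (simp add: odd_pairs_def partitions_def)
  qed
  then have "?f ` odd_pairs n \<subseteq> ?E" by blast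
  moreover have "finite ?E" using finite_partitions by simp
  ultimately show ?thesis
    unfolding p_ou_ed_def by (rule card_inj_on_le)
qed

section \<open>Turning even parts into odd parts\<close>

definition split_parts :: "nat list \<Rightarrow> nat list" where
  "split_parts xs = map (\<lambda>x. x - 1) xs @ replicate (length xs) 1"

definition on_rectangle :: "nat \<Rightarrow> nat \<Rightarrow> nat list \<Rightarrow> nat list" where
  "on_rectangle c l xs = map (\<lambda>x. x + c) xs @ replicate (l - length xs) c"

lemma sum_list_map_diff_1:
  "\<forall>x\<in>set xs. x > 0 \<Longrightarrow> sum_list (map (\<lambda>x. x - 1) xs) + length xs = sum_list (xs :: nat list)"
  by (induction xs) auto

lemma sorted_wrt_ge_replicate: "sorted_wrt (\<ge>) (replicate n (c :: nat))"
  by (simp add: sorted_wrt_iff_nth_less)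

lemma sorted_wrt_ge_map:
  assumes "sorted_wrt (\<ge>) xs" "mono f"
  shows "sorted_wrt (\<ge>) (map f xs)"
  unfolding sorted_wrt_map
  by (rule sorted_wrt_mono_rel[OF _ assms(1)]) (rule monoD[OF assms(2)])

lemma split_parts_props:
  assumes "sorted_wrt (\<ge>) xs" "\<forall>x\<in>set xs. x > 0 \<and> even x"
  shows "sorted_wrt (\<ge>) (split_parts xs)" "\<forall>y\<in>set (split_parts xs). odd y"
    "sum_list (split_parts xs) = sum_list xs" "length (split_parts xs) = 2 * length xs"
proof -
  have "x - 1 \<ge> 1" if "x \<in> set xs" for x
  proof -
    have "x > 0" "even x" using assms(2) that by auto
    then show ?thesis by presburger
  qed
  moreover have "mono (\<lambda>x::nat. x - 1)"
    by (intro monoI diff_le_mono)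
  ultimately show "sorted_wrt (\<ge>) (split_parts xs)"
    using sorted_wrt_ge_map[OF assms(1), of "\<lambda>x. x - 1"]
    by (simp add: split_parts_def sorted_wrt_append sorted_wrt_ge_replicate)
  show "\<forall>y\<in>set (split_parts xs). odd y"
    using assms(2) unfolding split_parts_def by auto
  show "sum_list (split_parts xs) = sum_list xs"
    using sum_list_map_diff_1[of xs] assms(2) unfolding split_parts_def
    by (simp add: sum_list_replicate)
qed (simp add: split_parts_def)

text \<open>Half the length locates the appended ones, and \<open>x - 1\<close> is injective on
  positive numbers.\<close>

lemma split_parts_inject:
  assumes "split_parts xs = split_parts ys" "\<forall>x\<in>set xs. x > 0" "\<forall>x\<in>set ys. x > 0"
  shows "xs = ys"
proof -
  have "length xs = length ys"
    using arg_cong[OF assms(1), of length] by (simp add: split_parts_def)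
  then have "map (\<lambda>x. x - 1) xs = map (\<lambda>x. x - 1) ys"
    using assms(1) by (simp add: split_parts_def)
  moreover have "inj_on (\<lambda>x::nat. x - 1) (set xs \<union> set ys)"
    using assms(2,3) by (auto simp: inj_on_def) (metis Suc_pred)+
  ultimately show ?thesis by (rule map_inj_on)
qed

lemma on_rectangle_props:
  assumes "sorted_wrt (\<ge>) xs" "\<forall>x\<in>set xs. even x" "odd c" "length xs \<le> l"
  shows "sorted_wrt (\<ge>) (on_rectangle c l xs)" "\<forall>y\<in>set (on_rectangle c l xs). odd y"
    "sum_list (on_rectangle c l xs) = sum_list xs + c * l" "length (on_rectangle c l xs) = l"
proof -
  have "sum_list (map (\<lambda>x. x + c) xs) = sum_list xs + c * length xs"
    by (induction xs) auto
  moreover have "c * l = c * length xs + (l - length xs) * c"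
    using assms(4) by (metis add.commute le_add_diff_inverse2 distrib_left mult.commute)
  ultimately show "sum_list (on_rectangle c l xs) = sum_list xs + c * l"
    by (simp add: on_rectangle_def sum_list_replicate)
  show "sorted_wrt (\<ge>) (on_rectangle c l xs)"
    using sorted_wrt_ge_map[OF assms(1), of "\<lambda>x. x + c"]
    by (auto simp: on_rectangle_def sorted_wrt_append sorted_wrt_ge_replicate mono_def)
qed (use assms in \<open>auto simp: on_rectangle_def\<close>)

text \<open>An entry untouched by \<open>xs\<close> survives and reveals \<open>c\<close>; the
  entries above \<open>c\<close> then determine \<open>xs\<close>.\<close>

lemma last_on_rectangle: "length xs < l \<Longrightarrow> last (on_rectangle c l xs) = c"
  by (simp add: on_rectangle_def)

lemma on_rectangle_inverse:
  assumes "\<forall>x\<in>set xs. x > 0"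
  shows "map (\<lambda>y. y - c) (filter (\<lambda>y. y > c) (on_rectangle c l xs)) = xs"
  using assms by (simp add: on_rectangle_def filter_map o_def)

section \<open>The injection and an element it misses\<close>

text \<open>The first test is the bound of \<open>odd_pairs\<close>, since
  \<open>split_parts\<close> doubles the length. In the last branch
  \<open>(k + 1) * (k - 1) + 1 = k * k\<close>, where \<open>1\<close> is the square of the new
  index.\<close>

definition even_to_odd :: "nat \<times> nat list \<Rightarrow> nat \<times> nat list" where
  "even_to_odd = (\<lambda>(k, xs).
     if k \<le> 2 * length xs then (k, split_parts xs)
     else if odd k then (0, on_rectangle k k xs)
     else (1, on_rectangle (k + 1) (k - 1) xs))"

text \<open>This separates the branches of \<open>even_to_odd\<close>: a kept index has the parity
  of \<open>n\<close>, a new index \<open>0\<close> or \<open>1\<close> the opposite one.\<close>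

lemma even_pairs_parity:
  assumes "(k, xs) \<in> even_pairs n"
  shows "odd k \<longleftrightarrow> odd n"
proof -
  have "even (sum_list xs)" if "\<forall>x\<in>set xs. even x"
    using that by (induction xs) auto
  then show ?thesis using assms by (auto simp: even_pairs_def)
qed

lemma even_to_odd_in_odd_pairs:
  assumes "p \<in> even_pairs n"
  shows "even_to_odd p \<in> odd_pairs n"
proof -
  obtain k xs where p: "p = (k, xs)" by fastforce
  have xs: "sorted_wrt (\<ge>) xs" "\<forall>x\<in>set xs. x > 0 \<and> even x" "sum_list xs + k * k = n"
    using assms p by (auto simp: even_pairs_def)
  consider "k \<le> 2 * length xs" | "k > 2 * length xs" "odd k" | "k > 2 * length xs" "even k"
    by linarith
  then show ?thesis
  proof cases
    case 1
    then show ?thesis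
      using xs split_parts_props[OF xs(1,2)] by (simp add: p even_to_odd_def odd_pairs_def)
  next
    case 2
    then show ?thesis
      using xs on_rectangle_props[of xs k k] by (simp add: p even_to_odd_def odd_pairs_def)
  next
    case 3
    \<comment> \<open>Being even and positive, \<open>k\<close> is at least 2, so the new list of
      length \<open>k - 1\<close> is nonempty, as index \<open>1\<close> demands.\<close>
    then obtain j where j: "k = Suc (Suc j)"
      by (metis less_nat_zero_code not0_implies_Suc odd_one One_nat_def)
    then show ?thesis
      using 3 xs on_rectangle_props[of xs "k + 1" "k - 1"]
      by (simp add: p even_to_odd_def odd_pairs_def)
  qed
qed

lemma inj_on_even_to_odd: "inj_on even_to_odd (even_pairs n)"
proof (rule inj_onI)
  fix p p' assume p: "p \<in> even_pairs n" "p' \<in> even_pairs n" "even_to_odd p = even_to_odd p'"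
  obtain k xs k' xs' where [simp]: "p = (k, xs)" "p' = (k', xs')" by fastforce
  have par: "odd k \<longleftrightarrow> odd n" "odd k' \<longleftrightarrow> odd n"
    using p even_pairs_parity by auto
  have pos: "\<forall>x\<in>set xs. x > 0" "\<forall>x\<in>set xs'. x > 0"
    using p by (auto simp: even_pairs_def)
  consider "k \<le> 2 * length xs" "k' \<le> 2 * length xs'"
    | "k > 2 * length xs" "k' > 2 * length xs'" "odd n"
    | "k > 2 * length xs" "k' > 2 * length xs'" "even n"
    | "(k \<le> 2 * length xs) \<noteq> (k' \<le> 2 * length xs')"
    by linarith
  then show "p = p'"
  proof cases
    case 1
    then show ?thesis using p(3) pos split_parts_inject by (simp add: even_to_odd_def)
  next
    case 2
    then have eq: "on_rectangle k k xs = on_rectangle k' k' xs'"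
      using p(3) par by (simp add: even_to_odd_def)
    have "k = k'"
      using arg_cong[OF eq, of last] 2 by (simp add: last_on_rectangle)
    then show ?thesis using eq pos on_rectangle_inverse by (metis \<open>p = _\<close> \<open>p' = _\<close>)
  next
    case 3
    then have eq: "on_rectangle (k + 1) (k - 1) xs = on_rectangle (k' + 1) (k' - 1) xs'"
      using p(3) par by (simp add: even_to_odd_def)
    \<comment> \<open>Evenness sharpens \<open>k > 2 * length xs\<close> to
      \<open>k \<ge> 2 * length xs + 2\<close>, so an untouched entry remains among
      \<open>k - 1\<close>.\<close>
    have "length xs < k - 1" "length xs' < k' - 1"
      using 3 par by presburger+
    then have "k = k'"
      using arg_cong[OF eq, of last] by (simp add: last_on_rectangle)
    then show ?thesis using eq pos on_rectangle_inverse by (metis \<open>p = _\<close> \<open>p' = _\<close>)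
  next
    case 4
    \<comment> \<open>The two image indices have opposite parities.\<close>
    then show ?thesis using p(3) par by (auto simp: even_to_odd_def split: if_splits)
  qed
qed

text \<open>An index of parity opposite to \<open>n\<close> arises only from a rectangle, whose last
  entry is \<open>k\<close> or \<open>k + 1\<close>. A last entry \<open>1\<close> would need
  \<open>k = 1\<close>, as \<open>k = 0\<close> never reaches a rectangle.\<close>

lemma even_to_odd_not_surj:
  assumes "n \<ge> 2"
  shows "\<exists>q \<in> odd_pairs n. q \<notin> even_to_odd ` even_pairs n"
proof -
  define i :: nat where "i = (if odd n then 0 else 1)"
  let ?ones = "replicate (n - i) (1 :: nat)"
  have "i \<le> 1" by (simp add: i_def)
  have "i = 0 \<or> i = 1" by (simp add: i_def)
  then have "n - i + i * i = n" "i \<le> n - i"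
    using assms by (elim disjE; simp)+
  then have "(i, ?ones) \<in> odd_pairs n"
    using sorted_wrt_ge_replicate[of "n - i" 1]
    by (simp add: odd_pairs_def sum_list_replicate)
  moreover have "(i, ?ones) \<noteq> even_to_odd (k, xs)" if kxs: "(k, xs) \<in> even_pairs n" for k xs
  proof
    assume q: "(i, ?ones) = even_to_odd (k, xs)"
    have par: "odd k \<longleftrightarrow> odd n" using even_pairs_parity kxs by blast
    moreover have "odd i \<longleftrightarrow> even n" by (simp add: i_def)
    ultimately have "i \<noteq> k" by metis
    have large: "k > 2 * length xs"
    proof (rule ccontr)
      assume "\<not> k > 2 * length xs"
      then show False using q \<open>i \<noteq> k\<close> by (simp add: even_to_odd_def)
    qed
    have ones: "last ?ones = 1"
      using assms \<open>i \<le> 1\<close> by simp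
    show False
    proof (cases "odd k")
      case True
      then have "on_rectangle k k xs = ?ones"
        using arg_cong[OF q, of snd] large by (simp add: even_to_odd_def)
      then have "k = 1" using ones last_on_rectangle[of xs k k] large by simp
      \<comment> \<open>With \<open>k = 1\<close>, the bound \<open>large\<close> forces
        \<open>xs\<close> to be empty.\<close>
      then have "n = 1" using kxs large by (simp add: even_pairs_def)
      then show False using assms by simp
    next
      case False
      then have "on_rectangle (k + 1) (k - 1) xs = ?ones"
        using arg_cong[OF q, of snd] large by (simp add: even_to_odd_def)
      moreover have "length xs < k - 1" using False large by presburger
      ultimately have "k + 1 = 1" using ones last_on_rectangle[of xs "k - 1" "k + 1"] by simp
      then show False using large by simp
    qed
  qed
  then have "(i, ?ones) \<notin> even_to_odd ` even_pairs n" by fast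
  ultimately show ?thesis by blast
qed

theorem theorem3p5:
  shows "(\<forall>n::nat. p_eu_od n \<le> p_ou_ed n) \<and> (\<forall>n::nat. n \<ge> 2 \<longrightarrow> p_eu_od n < p_ou_ed n)"
proof (intro conjI allI impI)
  fix n :: nat
  have image: "even_to_odd ` even_pairs n \<subseteq> odd_pairs n"
    using even_to_odd_in_odd_pairs by blast
  have "card (even_pairs n) \<le> card (odd_pairs n)"
    using inj_on_even_to_odd image finite_odd_pairs by (rule card_inj_on_le)
  then show "p_eu_od n \<le> p_ou_ed n"
    using p_eu_od_le_card_even_pairs[of n] card_odd_pairs_le_p_ou_ed[of n] by linarith
  assume "n \<ge> 2"
  then have "even_to_odd ` even_pairs n \<subset> odd_pairs n"
    using even_to_odd_not_surj[of n] image by blast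
  then have "card (even_to_odd ` even_pairs n) < card (odd_pairs n)"
    by (rule psubset_card_mono[OF finite_odd_pairs])
  then have "card (even_pairs n) < card (odd_pairs n)"
    by (simp add: card_image inj_on_even_to_odd)
  then show "p_eu_od n < p_ou_ed n"
    using p_eu_od_le_card_even_pairs[of n] card_odd_pairs_le_p_ou_ed[of n] by linarith
qed

end
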